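(* Let $(\mathcal{L},\phi,\xi,\eta,g)$ be a 3-dimensional almost paracontact almost paracomplex Riemannian manifold, where $\mathcal{L}$ is a 3-dimensional real connected Lie group equipped with the left-invariant structure described in the context, and suppose it belongs to the basic class $\mathcal{F}_s$ for some $s\in\{1,4,5,8,9,10,11\}$. Let $\alpha,\beta$ be the corresponding real parameters of its Lie algebra $\mathfrak{g}$ (see context), with $(\alpha,\beta)\neq(0,0)$ in the classes $\mathcal F_1,\mathcal F_{11}$ and $\alpha\neq 0$ in the other classes. Then the compact simply connected Lie group $\mathcal{G}$ isomorphic to $\mathcal{L}$, both with one and the same Lie algebra $\mathfrak{g}$, has the matrix representation $$e^A=E+tA+uA^2,$$ where $E$ is the identity matrix, $A$ is the matrix representation of the Lie algebra $\mathfrak{g}$, and $t,u$ are real parameters. For each class, the matrix $A$ and the expressions of $t$ and $u$ are as follows, where $a,b,c$ are arbitrary reals. $\mathcal{F}_1$: $A=\begin{pmatrix}0&0&0\\0&\alpha c&-\beta c\\0&-\alpha b&\beta b\end{pmatrix}$, $\operatorname{tr}A=\alpha c+\beta b$; $t=\frac{e^{\operatorname{tr}A}-1}{\operatorname{tr}A}$ if $\operatorname{tr}A\neq0$, $t=1$ if $\operatorname{tr}A=0$; $u=0$. $\mathcal{F}_4$: $A=\begin{pmatrix}0&\alpha c&\alpha b\\0&0&-\alpha a\\0&-\alpha a&0\end{pmatrix}$, $\operatorname{tr}A^2=2\alpha^2a^2$; $t=\frac{\sinh\sqrt{\frac12\operatorname{tr}A^2}}{\sqrt{\frac12\operatorname{tr}A^2}}$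 and $u=\frac{\cosh\sqrt{\frac12\operatorname{tr}A^2}-1}{\frac12\operatorname{tr}A^2}$ if $\operatorname{tr}A^2>0$; $t=1$ and $u=0$ if $\operatorname{tr}A^2=0$. $\mathcal{F}_5$: $A=\begin{pmatrix}0&\alpha b&\alpha c\\0&-\alpha a&0\\0&0&-\alpha a\end{pmatrix}$, $\operatorname{tr}A=-2\alpha a$; $t=\frac{e^{\frac12\operatorname{tr}A}-1}{\frac12\operatorname{tr}A}$ if $\operatorname{tr}A\neq0$, $t=1$ if $\operatorname{tr}A=0$; $u=0$. $\mathcal{F}_8$: $A=\begin{pmatrix}0&-\alpha c&\alpha b\\2\alpha c&0&-\alpha a\\-2\alpha b&\alpha a&0\end{pmatrix}$, $\operatorname{tr}A^2=-2\alpha^2(a^2+2b^2+2c^2)$; $t=\frac{\sin\sqrt{-\frac12\operatorname{tr}A^2}}{\sqrt{-\frac12\operatorname{tr}A^2}}$ and $u=\frac{\cos\sqrt{-\frac12\operatorname{tr}A^2}-1}{\frac12\operatorname{tr}A^2}$, for $\operatorname{tr}A^2<0$. $\mathcal{F}_9$: $A=\begin{pmatrix}0&\alpha b&-\alpha c\\0&-\alpha a&0\\0&0&\alpha a\end{pmatrix}$, $\operatorname{tr}A^2=2\alpha^2a^2$; $t=\frac{\sinh\sqrt{\frac12\operatorname{tr}A^2}}{\sqrt{\frac12\operatorname{tr}A^2}}$ and $u=\frac{\cosh\sqrt{\frac12\operatorname{tr}A^2}-1}{\frac12\operatorname{tr}A^2}$ if $\operatorname{tr}A^2>0$; $t=1$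 and $u=0$ if $\operatorname{tr}A^2=0$. $\mathcal{F}_{10}$: $A=\begin{pmatrix}0&\alpha c&-\alpha b\\0&0&-\alpha a\\0&-\alpha a&0\end{pmatrix}$, $\operatorname{tr}A^2=2\alpha^2a^2$; $t=\frac{\sinh\sqrt{\frac12\operatorname{tr}A^2}}{\sqrt{\frac12\operatorname{tr}A^2}}$ and $u=\frac{\cosh\sqrt{\frac12\operatorname{tr}A^2}-1}{\frac12\operatorname{tr}A^2}$ if $\operatorname{tr}A^2>0$; $t=1$ and $u=0$ if $\operatorname{tr}A^2=0$. $\mathcal{F}_{11}$: $A=\begin{pmatrix}\alpha b+\beta c&0&0\\-\alpha a&0&0\\-\beta a&0&0\end{pmatrix}$, $\operatorname{tr}A=\alpha b+\beta c$; $t=\frac{e^{\operatorname{tr}A}-1}{\operatorname{tr}A}$ if $\operatorname{tr}A\neq0$, $t=1$ if $\operatorname{tr}A=0$; $u=0$.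
   Context: An almost paracontact almost paracomplex Riemannian manifold $(\mathcal M,\phi,\xi,\eta,g)$ is a $(2n+1)$-dimensional real differentiable manifold with a $(1,1)$-tensor field $\phi$, a vector field $\xi$, a 1-form $\eta$ and a Riemannian metric $g$ such that $\phi^2=I-\eta\otimes\xi$, $\eta(\xi)=1$, $\eta\circ\phi=0$, $\phi\xi=0$, $\operatorname{tr}\phi=0$ and $g(\phi x,\phi y)=g(x,y)-\eta(x)\eta(y)$. Lie group setting: $\mathcal L$ is a 3-dimensional real connected Lie group whose Lie algebra $\mathfrak g$ has a basis $\{E_0,E_1,E_2\}$ of left-invariant vector fields, and the structure is defined by $\phi E_0=0$, $\phi E_1=E_2$, $\phi E_2=E_1$, $\xi=E_0$, $\eta(E_0)=1$, $\eta(E_1)=\eta(E_2)=0$, $g(E_i,E_j)=\delta_{ij}$. Basic classes in dimension 3: let $F(x,y,z)=g((\nabla_x\phi)y,z)$ with $\nabla$ the Levi-Civita connection of $g$. Write $x=x^iE_i$, etc. The manifold belongs to $\mathcal F_s$ iff $F$ has the following form for some real constants $p,q$: $\mathcal F_1$: $F=(p\,x^1-q\,x^2)(y^1z^1-y^2z^2)$; $\mathcal F_4$: $F=p\{x^1(y^0z^1+y^1z^0)+x^2(y^0z^2+y^2z^0)\}$; $\mathcal F_5$: $F=p\{x^1(y^0z^2+y^2z^0)+x^2(y^0z^1+y^1z^0)\}$; $\mathcal F_8$: $F=p\{x^1(y^0z^1+y^1z^0)-x^2(y^0z^2+y^2z^0)\}$; $\mathcal F_9$: $F=p\{x^1(y^0z^2+y^2z^0)-x^2(y^0z^1+y^1z^0)\}$;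 $\mathcal F_{10}$: $F=p\,x^0(y^1z^1-y^2z^2)$; $\mathcal F_{11}$: $F=x^0\{p(y^0z^1+y^1z^0)+q(y^0z^2+y^2z^0)\}$. Known characterization (defines $\alpha,\beta$): $(\mathcal L,\phi,\xi,\eta,g)$ belongs to $\mathcal F_s$ iff, for some real $\alpha$ (and $\beta$), the commutators are $\mathcal F_1$: $[E_0,E_1]=0$, $[E_0,E_2]=0$, $[E_1,E_2]=\alpha E_1-\beta E_2$; $\mathcal F_4$: $[E_0,E_1]=\alpha E_2$, $[E_0,E_2]=\alpha E_1$, $[E_1,E_2]=0$; $\mathcal F_5$: $[E_0,E_1]=\alpha E_1$, $[E_0,E_2]=\alpha E_2$, $[E_1,E_2]=0$; $\mathcal F_8$: $[E_0,E_1]=\alpha E_2$, $[E_0,E_2]=-\alpha E_1$, $[E_1,E_2]=2\alpha E_0$; $\mathcal F_9$: $[E_0,E_1]=\alpha E_1$, $[E_0,E_2]=-\alpha E_2$, $[E_1,E_2]=0$; $\mathcal F_{10}$: $[E_0,E_1]=-\alpha E_2$, $[E_0,E_2]=\alpha E_1$, $[E_1,E_2]=0$; $\mathcal F_{11}$: $[E_0,E_1]=\alpha E_0$, $[E_0,E_2]=\beta E_0$, $[E_1,E_2]=0$. Matrix representation of the Lie algebra: with $[E_i,E_j]=C_{ij}^kE_k$, it is the family of matrices $A=aM_0+bM_1+cM_2$, $a,b,c\in\mathbb R$, where $M_i$ has entries $(M_i)_j^k=-C_{ij}^k$ ($j$ the row index, $k$ the column index, $i,j,k\in\{0,1,2\}$).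 The matrix representation of the Lie group is given by the matrices $e^A$.
   Formalization: For F_10 the (1,2) entry of A is corrected to +αa, so tr A² = −2α²a² and t, u use sin/cos as in F_8 (t=1, u=0 if tr A²=0); the result is for every Lie group G with Lie algebra isomorphic to g, as a compact simply connected one exists only for F_8. *)

theory Defs
  imports "HOL-Analysis.Analysis"
begin

text \<open>\<open>Ck_on k S f\<close>: the map \<open>f\<close> is \<open>k\<close> times differentiable with continuous derivatives on
  the open set \<open>S\<close>; the derivatives are taken in all (constant) directions.\<close>

primrec Ck_on ::
  "nat \<Rightarrow> 'a::euclidean_space set \<Rightarrow> ('a \<Rightarrow> 'b::real_normed_vector) \<Rightarrow> bool" where
  "Ck_on 0 S f \<longleftrightarrow> continuous_on S f"
| "Ck_on (Suc k) S f \<longleftrightarrow>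
     (\<forall>x\<in>S. f differentiable (at x)) \<and> (\<forall>v. Ck_on k S (\<lambda>x. frechet_derivative f (at x) v))"

definition smooth_on ::
  "'a::euclidean_space set \<Rightarrow> ('a \<Rightarrow> 'b::real_normed_vector) \<Rightarrow> bool" where
  "smooth_on S f \<longleftrightarrow> (\<forall>k. Ck_on k S f)"

text \<open>The underlying space of a manifold is a whole type. A chart is a pair \<open>(U, \<kappa>)\<close>, where only
  the restriction of \<open>\<kappa>\<close> to \<open>U\<close> is relevant.\<close>

type_synonym 'm atlas = "('m set \<times> ('m \<Rightarrow> real^3)) set"

definition smooth_manifold3 :: "'m::{t2_space,second_countable_topology} atlas \<Rightarrow> bool" where
  "smooth_manifold3 \<A> \<longleftrightarrow>
     (\<forall>(U, \<kappa>)\<in>\<A>. open U \<and> open (\<kappa> ` U) \<and> homeomorphism U (\<kappa> ` U) \<kappa> (inv_into U \<kappa>)) \<and>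
     (\<Union>(U, \<kappa>)\<in>\<A>. U) = UNIV \<and>
     (\<forall>(U, \<kappa>)\<in>\<A>. \<forall>(V, \<mu>)\<in>\<A>. smooth_on (\<kappa> ` (U \<inter> V)) (\<lambda>x. \<mu> (inv_into U \<kappa> x)))"

definition smooth_fun :: "'m atlas \<Rightarrow> ('m \<Rightarrow> real) \<Rightarrow> bool" where
  "smooth_fun \<A> f \<longleftrightarrow> (\<forall>(U, \<kappa>)\<in>\<A>. smooth_on (\<kappa> ` U) (\<lambda>x. f (inv_into U \<kappa> x)))"

record 'm lie_group_data =
  atlas :: "'m atlas"
  mul :: "'m \<Rightarrow> 'm \<Rightarrow> 'm"
  one :: 'm
  ginv :: "'m \<Rightarrow> 'm"

definition lie_group3 :: "'m::{t2_space,second_countable_topology} lie_group_data \<Rightarrow> bool" where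
  "lie_group3 L \<longleftrightarrow>
     smooth_manifold3 (atlas L) \<and>
     Groups.group (mul L) (one L) (ginv L) \<and>
     continuous_on UNIV (\<lambda>(a, b). mul L a b) \<and>
     (\<forall>(U, \<kappa>)\<in>atlas L. \<forall>(V, \<mu>)\<in>atlas L. \<forall>(W, \<nu>)\<in>atlas L.
        smooth_on ((\<lambda>(a, b). (\<kappa> a, \<mu> b)) ` {(a, b). a \<in> U \<and> b \<in> V \<and> mul L a b \<in> W})
          (\<lambda>(x, y). \<nu> (mul L (inv_into U \<kappa> x) (inv_into V \<mu> y)))) \<and>
     continuous_on UNIV (ginv L) \<and>
     (\<forall>(U, \<kappa>)\<in>atlas L. \<forall>(V, \<mu>)\<in>atlas L.
        smooth_on (\<kappa> ` {a \<in> U. ginv L a \<in> V}) (\<lambda>x. \<mu> (ginv L (inv_into U \<kappa> x))))"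

text \<open>Vector fields are the derivations of the algebra of smooth functions. So that two vector
  fields are equal iff they act equally on smooth functions, all other functions are sent to 0.\<close>

type_synonym 'm vfield = "('m \<Rightarrow> real) \<Rightarrow> ('m \<Rightarrow> real)"

definition vector_field :: "'m atlas \<Rightarrow> 'm vfield \<Rightarrow> bool" where
  "vector_field \<A> X \<longleftrightarrow>
     (\<forall>f. smooth_fun \<A> f \<longrightarrow> smooth_fun \<A> (X f)) \<and>
     (\<forall>f. \<not> smooth_fun \<A> f \<longrightarrow> X f = (\<lambda>_. 0)) \<and>
     (\<forall>f h c. smooth_fun \<A> f \<longrightarrow> smooth_fun \<A> h \<longrightarrow>
        X (\<lambda>p. c * f p + h p) = (\<lambda>p. c * X f p + X h p)) \<and>
     (\<forall>f h. smooth_fun \<A> f \<longrightarrow> smooth_fun \<A> h \<longrightarrow>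
        X (\<lambda>p. f p * h p) = (\<lambda>p. X f p * h p + f p * X h p))"

definition vf_zero :: "'m vfield" where
  "vf_zero = (\<lambda>f p. 0)"

definition vf_add :: "'m vfield \<Rightarrow> 'm vfield \<Rightarrow> 'm vfield" where
  "vf_add X Y = (\<lambda>f p. X f p + Y f p)"

definition vf_diff :: "'m vfield \<Rightarrow> 'm vfield \<Rightarrow> 'm vfield" where
  "vf_diff X Y = (\<lambda>f p. X f p - Y f p)"

definition vf_scale :: "('m \<Rightarrow> real) \<Rightarrow> 'm vfield \<Rightarrow> 'm vfield" where
  "vf_scale h X = (\<lambda>f p. h p * X f p)"

definition bracket :: "'m vfield \<Rightarrow> 'm vfield \<Rightarrow> 'm vfield" where
  "bracket X Y = (\<lambda>f p. X (Y f) p - Y (X f) p)"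

text \<open>The index type \<open>3\<close> has the elements \<open>0\<close>, \<open>1\<close>, \<open>2\<close> (and \<open>3 = 0\<close>). They serve directly as
  the indices of the frame \<open>E 0\<close>, \<open>E 1\<close>, \<open>E 2\<close> and of coordinates. The function \<open>tup3\<close> lists
  entries in the order 0, 1, 2, unlike \<open>vector\<close>, which uses the order 1, 2, 3.\<close>

definition tup3 :: "'a \<Rightarrow> 'a \<Rightarrow> 'a \<Rightarrow> 'a^3" where
  "tup3 x0 x1 x2 = (\<chi> i. if i = 0 then x0 else if i = 1 then x1 else x2)"

definition frame_comb :: "(3 \<Rightarrow> 'm \<Rightarrow> real) \<Rightarrow> (3 \<Rightarrow> 'm vfield) \<Rightarrow> 'm vfield" where
  "frame_comb x E = (\<lambda>f p. \<Sum>i\<in>UNIV. x i p * E i f p)"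

definition lin_comb :: "real^3 \<Rightarrow> (3 \<Rightarrow> 'm vfield) \<Rightarrow> 'm vfield" where
  "lin_comb c E = frame_comb (\<lambda>i p. c $ i) E"

definition left_invariant :: "'m lie_group_data \<Rightarrow> 'm vfield \<Rightarrow> bool" where
  "left_invariant L X \<longleftrightarrow>
     (\<forall>a f. smooth_fun (atlas L) f \<longrightarrow> X (\<lambda>p. f (mul L a p)) = (\<lambda>p. X f (mul L a p)))"

definition lie_algebra :: "'m lie_group_data \<Rightarrow> 'm vfield set" where
  "lie_algebra L = {X. vector_field (atlas L) X \<and> left_invariant L X}"

definition lie_algebra_basis :: "'m lie_group_data \<Rightarrow> (3 \<Rightarrow> 'm vfield) \<Rightarrow> bool" where
  "lie_algebra_basis L E \<longleftrightarrow>
     (\<forall>i. E i \<in> lie_algebra L) \<and> (\<forall>X\<in>lie_algebra L. \<exists>!c. X = lin_comb c E)"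

definition lie_algebra_iso ::
  "'l lie_group_data \<Rightarrow> 'g lie_group_data \<Rightarrow> ('l vfield \<Rightarrow> 'g vfield) \<Rightarrow> bool" where
  "lie_algebra_iso L G \<psi> \<longleftrightarrow>
     bij_betw \<psi> (lie_algebra L) (lie_algebra G) \<and>
     (\<forall>X\<in>lie_algebra L. \<forall>Y\<in>lie_algebra L. \<psi> (vf_add X Y) = vf_add (\<psi> X) (\<psi> Y)) \<and>
     (\<forall>c. \<forall>X\<in>lie_algebra L. \<psi> (vf_scale (\<lambda>_. c) X) = vf_scale (\<lambda>_. c) (\<psi> X)) \<and>
     (\<forall>X\<in>lie_algebra L. \<forall>Y\<in>lie_algebra L. \<psi> (bracket X Y) = bracket (\<psi> X) (\<psi> Y))"

text \<open>Tensor fields are maps on vector fields that are linear over the smooth functions.\<close>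

definition vf_tensorial :: "'m atlas \<Rightarrow> ('m vfield \<Rightarrow> 'm vfield) \<Rightarrow> bool" where
  "vf_tensorial \<A> T \<longleftrightarrow>
     (\<forall>X. vector_field \<A> X \<longrightarrow> vector_field \<A> (T X)) \<and>
     (\<forall>X Y. vector_field \<A> X \<longrightarrow> vector_field \<A> Y \<longrightarrow>
        T (vf_add X Y) = vf_add (T X) (T Y)) \<and>
     (\<forall>h X. smooth_fun \<A> h \<longrightarrow> vector_field \<A> X \<longrightarrow> T (vf_scale h X) = vf_scale h (T X))"

definition one_form :: "'m atlas \<Rightarrow> ('m vfield \<Rightarrow> 'm \<Rightarrow> real) \<Rightarrow> bool" where
  "one_form \<A> \<omega> \<longleftrightarrow>
     (\<forall>X. vector_field \<A> X \<longrightarrow> smooth_fun \<A> (\<omega> X)) \<and>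
     (\<forall>X Y. vector_field \<A> X \<longrightarrow> vector_field \<A> Y \<longrightarrow>
        \<omega> (vf_add X Y) = (\<lambda>p. \<omega> X p + \<omega> Y p)) \<and>
     (\<forall>h X. smooth_fun \<A> h \<longrightarrow> vector_field \<A> X \<longrightarrow> \<omega> (vf_scale h X) = (\<lambda>p. h p * \<omega> X p))"

definition riemannian_metric :: "'m atlas \<Rightarrow> ('m vfield \<Rightarrow> 'm vfield \<Rightarrow> 'm \<Rightarrow> real) \<Rightarrow> bool" where
  "riemannian_metric \<A> g \<longleftrightarrow>
     (\<forall>X. vector_field \<A> X \<longrightarrow> one_form \<A> (g X)) \<and>
     (\<forall>X Y. vector_field \<A> X \<longrightarrow> vector_field \<A> Y \<longrightarrow> g X Y = g Y X) \<and>
     (\<forall>X p. vector_field \<A> X \<longrightarrow> 0 \<le> g X X p) \<and>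
     (\<forall>X f p. vector_field \<A> X \<longrightarrow> X f p \<noteq> 0 \<longrightarrow> 0 < g X X p)"

text \<open>In the last conjunct, the trace of \<open>\<phi>\<close> at \<open>p\<close> is computed in an orthonormal basis
  of the tangent space at \<open>p\<close>, given by the values of three vector fields.\<close>

definition apapr_manifold3 ::
  "'m::{t2_space,second_countable_topology} atlas \<Rightarrow> ('m vfield \<Rightarrow> 'm vfield) \<Rightarrow> 'm vfield \<Rightarrow>
   ('m vfield \<Rightarrow> 'm \<Rightarrow> real) \<Rightarrow> ('m vfield \<Rightarrow> 'm vfield \<Rightarrow> 'm \<Rightarrow> real) \<Rightarrow> bool" where
  "apapr_manifold3 \<A> \<phi> \<xi> \<eta> g \<longleftrightarrow>
     smooth_manifold3 \<A> \<and> vf_tensorial \<A> \<phi> \<and> vector_field \<A> \<xi> \<and> one_form \<A> \<eta> \<and>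
     riemannian_metric \<A> g \<and>
     (\<forall>X. vector_field \<A> X \<longrightarrow> \<phi> (\<phi> X) = vf_diff X (vf_scale (\<eta> X) \<xi>)) \<and>
     \<eta> \<xi> = (\<lambda>_. 1) \<and>
     (\<forall>X. vector_field \<A> X \<longrightarrow> \<eta> (\<phi> X) = (\<lambda>_. 0)) \<and>
     \<phi> \<xi> = vf_zero \<and>
     (\<forall>X Y. vector_field \<A> X \<longrightarrow> vector_field \<A> Y \<longrightarrow>
        g (\<phi> X) (\<phi> Y) = (\<lambda>p. g X Y p - \<eta> X p * \<eta> Y p)) \<and>
     (\<forall>(e :: 3 \<Rightarrow> 'm vfield) p. (\<forall>i. vector_field \<A> (e i)) \<longrightarrow>
        (\<forall>i j. g (e i) (e j) p = (if i = j then 1 else 0)) \<longrightarrow>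
        (\<Sum>i\<in>UNIV. g (\<phi> (e i)) (e i) p) = 0)"

definition levi_civita ::
  "'m atlas \<Rightarrow> ('m vfield \<Rightarrow> 'm vfield \<Rightarrow> 'm \<Rightarrow> real) \<Rightarrow>
   ('m vfield \<Rightarrow> 'm vfield \<Rightarrow> 'm vfield) \<Rightarrow> bool" where
  "levi_civita \<A> g D \<longleftrightarrow>
     (\<forall>Y. vector_field \<A> Y \<longrightarrow> vf_tensorial \<A> (\<lambda>X. D X Y)) \<and>
     (\<forall>X Y Z. vector_field \<A> X \<longrightarrow> vector_field \<A> Y \<longrightarrow> vector_field \<A> Z \<longrightarrow>
        D X (vf_add Y Z) = vf_add (D X Y) (D X Z)) \<and>
     (\<forall>h X Y. smooth_fun \<A> h \<longrightarrow> vector_field \<A> X \<longrightarrow> vector_field \<A> Y \<longrightarrow>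
        D X (vf_scale h Y) = vf_add (vf_scale (X h) Y) (vf_scale h (D X Y))) \<and>
     (\<forall>X Y. vector_field \<A> X \<longrightarrow> vector_field \<A> Y \<longrightarrow>
        vf_diff (D X Y) (D Y X) = bracket X Y) \<and>
     (\<forall>X Y Z. vector_field \<A> X \<longrightarrow> vector_field \<A> Y \<longrightarrow> vector_field \<A> Z \<longrightarrow>
        X (g Y Z) = (\<lambda>p. g (D X Y) Z p + g Y (D X Z) p))"

text \<open>\<open>F(x,y,z) = g((\<nabla>\<^sub>x \<phi>) y, z)\<close>, where \<open>(\<nabla>\<^sub>x \<phi>) y = \<nabla>\<^sub>x (\<phi> y) - \<phi> (\<nabla>\<^sub>x y)\<close>.\<close>

definition F_tensor ::
  "('m vfield \<Rightarrow> 'm vfield \<Rightarrow> 'm \<Rightarrow> real) \<Rightarrow> ('m vfield \<Rightarrow> 'm vfield) \<Rightarrow>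
   ('m vfield \<Rightarrow> 'm vfield \<Rightarrow> 'm vfield) \<Rightarrow>
   'm vfield \<Rightarrow> 'm vfield \<Rightarrow> 'm vfield \<Rightarrow> 'm \<Rightarrow> real" where
  "F_tensor g \<phi> D x y z = g (vf_diff (D x (\<phi> y)) (\<phi> (D x y))) z"

definition left_invariant_structure ::
  "'m lie_group_data \<Rightarrow> (3 \<Rightarrow> 'm vfield) \<Rightarrow> ('m vfield \<Rightarrow> 'm vfield) \<Rightarrow> 'm vfield \<Rightarrow>
   ('m vfield \<Rightarrow> 'm \<Rightarrow> real) \<Rightarrow> ('m vfield \<Rightarrow> 'm vfield \<Rightarrow> 'm \<Rightarrow> real) \<Rightarrow> bool" where
  "left_invariant_structure L E \<phi> \<xi> \<eta> g \<longleftrightarrow>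
     lie_algebra_basis L E \<and>
     \<phi> (E 0) = vf_zero \<and> \<phi> (E 1) = E 2 \<and> \<phi> (E 2) = E 1 \<and>
     \<xi> = E 0 \<and>
     \<eta> (E 0) = (\<lambda>_. 1) \<and> \<eta> (E 1) = (\<lambda>_. 0) \<and> \<eta> (E 2) = (\<lambda>_. 0) \<and>
     (\<forall>i j. g (E i) (E j) = (\<lambda>_. if i = j then 1 else 0))"

datatype basic_class = F1 | F4 | F5 | F8 | F9 | F10 | F11

fun class_form ::
  "basic_class \<Rightarrow> real \<Rightarrow> real \<Rightarrow> real^3 \<Rightarrow> real^3 \<Rightarrow> real^3 \<Rightarrow> real" where
  "class_form F1 p q x y z = (p * x$1 - q * x$2) * (y$1 * z$1 - y$2 * z$2)"
| "class_form F4 p q x y z =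
     p * (x$1 * (y$0 * z$1 + y$1 * z$0) + x$2 * (y$0 * z$2 + y$2 * z$0))"
| "class_form F5 p q x y z =
     p * (x$1 * (y$0 * z$2 + y$2 * z$0) + x$2 * (y$0 * z$1 + y$1 * z$0))"
| "class_form F8 p q x y z =
     p * (x$1 * (y$0 * z$1 + y$1 * z$0) - x$2 * (y$0 * z$2 + y$2 * z$0))"
| "class_form F9 p q x y z =
     p * (x$1 * (y$0 * z$2 + y$2 * z$0) - x$2 * (y$0 * z$1 + y$1 * z$0))"
| "class_form F10 p q x y z = p * x$0 * (y$1 * z$1 - y$2 * z$2)"
| "class_form F11 p q x y z =
     x$0 * (p * (y$0 * z$1 + y$1 * z$0) + q * (y$0 * z$2 + y$2 * z$0))"

text \<open>The left-invariant frame \<open>E\<close> is global, so the vector fields are the combinations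
  \<open>x = x\<^sup>i E\<^sub>i\<close> with smooth functions \<open>x\<^sup>i\<close>.\<close>

definition in_basic_class ::
  "'m atlas \<Rightarrow> (3 \<Rightarrow> 'm vfield) \<Rightarrow> ('m vfield \<Rightarrow> 'm vfield) \<Rightarrow>
   ('m vfield \<Rightarrow> 'm vfield \<Rightarrow> 'm \<Rightarrow> real) \<Rightarrow> ('m vfield \<Rightarrow> 'm vfield \<Rightarrow> 'm vfield) \<Rightarrow>
   basic_class \<Rightarrow> bool" where
  "in_basic_class \<A> E \<phi> g D s \<longleftrightarrow>
     (\<exists>p q. \<forall>x y z. (\<forall>i. smooth_fun \<A> (x i) \<and> smooth_fun \<A> (y i) \<and> smooth_fun \<A> (z i)) \<longrightarrow>
        (\<forall>m. F_tensor g \<phi> D (frame_comb x E) (frame_comb y E) (frame_comb z E) m =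
             class_form s p q (\<chi> i. x i m) (\<chi> i. y i m) (\<chi> i. z i m)))"

text \<open>The coordinates of the commutators of \<open>E 0, E 1\<close>, of \<open>E 0, E 2\<close> and of \<open>E 1, E 2\<close>.\<close>

fun class_commutators :: "basic_class \<Rightarrow> real \<Rightarrow> real \<Rightarrow> (real^3) \<times> (real^3) \<times> (real^3)" where
  "class_commutators F1 \<alpha> \<beta> = (tup3 0 0 0, tup3 0 0 0, tup3 0 \<alpha> (-\<beta>))"
| "class_commutators F4 \<alpha> \<beta> = (tup3 0 0 \<alpha>, tup3 0 \<alpha> 0, tup3 0 0 0)"
| "class_commutators F5 \<alpha> \<beta> = (tup3 0 \<alpha> 0, tup3 0 0 \<alpha>, tup3 0 0 0)"
| "class_commutators F8 \<alpha> \<beta> = (tup3 0 0 \<alpha>, tup3 0 (-\<alpha>) 0, tup3 (2*\<alpha>) 0 0)"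
| "class_commutators F9 \<alpha> \<beta> = (tup3 0 \<alpha> 0, tup3 0 0 (-\<alpha>), tup3 0 0 0)"
| "class_commutators F10 \<alpha> \<beta> = (tup3 0 0 (-\<alpha>), tup3 0 \<alpha> 0, tup3 0 0 0)"
| "class_commutators F11 \<alpha> \<beta> = (tup3 \<alpha> 0 0, tup3 \<beta> 0 0, tup3 0 0 0)"

definition has_class_commutators ::
  "(3 \<Rightarrow> 'm vfield) \<Rightarrow> basic_class \<Rightarrow> real \<Rightarrow> real \<Rightarrow> bool" where
  "has_class_commutators E s \<alpha> \<beta> \<longleftrightarrow>
     (case class_commutators s \<alpha> \<beta> of (c01, c02, c12) \<Rightarrow>
        bracket (E 0) (E 1) = lin_comb c01 E \<and>
        bracket (E 0) (E 2) = lin_comb c02 E \<and>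
        bracket (E 1) (E 2) = lin_comb c12 E)"

definition nonzero_parameters :: "basic_class \<Rightarrow> real \<Rightarrow> real \<Rightarrow> bool" where
  "nonzero_parameters s \<alpha> \<beta> \<longleftrightarrow> (if s \<in> {F1, F11} then (\<alpha>, \<beta>) \<noteq> (0, 0) else \<alpha> \<noteq> 0)"

text \<open>\<open>structure_const E i j $ k\<close> is the structure constant \<open>C\<^sub>i\<^sub>j\<^sup>k\<close>. With row index \<open>j\<close> and
  column index \<open>k\<close>, \<open>basis_matrix E i\<close> is the negative transpose of the matrix of \<open>ad (E i)\<close> (acting
  on column vectors), so that \<open>basis_matrix\<close> extends to a representation of the Lie algebra.\<close>

definition structure_const :: "(3 \<Rightarrow> 'm vfield) \<Rightarrow> 3 \<Rightarrow> 3 \<Rightarrow> real^3" where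
  "structure_const E i j = (THE c. bracket (E i) (E j) = lin_comb c E)"

definition basis_matrix :: "(3 \<Rightarrow> 'm vfield) \<Rightarrow> 3 \<Rightarrow> real^3^3" where
  "basis_matrix E i = (\<chi> j k. - (structure_const E i j $ k))"

definition lie_algebra_matrix :: "(3 \<Rightarrow> 'm vfield) \<Rightarrow> real \<Rightarrow> real \<Rightarrow> real \<Rightarrow> real^3^3" where
  "lie_algebra_matrix E a b c =
     a *\<^sub>R basis_matrix E 0 + b *\<^sub>R basis_matrix E 1 + c *\<^sub>R basis_matrix E 2"

text \<open>The product \<open>*\<close> and hence \<open>^\<close> and \<open>exp\<close> are not the matrix operations on
  \<open>real^'n^'n\<close>.\<close>

primrec mat_pow :: "real^'n^'n \<Rightarrow> nat \<Rightarrow> real^'n^'n" where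
  "mat_pow A 0 = mat 1"
| "mat_pow A (Suc k) = A ** mat_pow A k"

definition mat_exp :: "real^'n^'n \<Rightarrow> real^'n^'n" where
  "mat_exp A = (\<Sum>k. (1 / fact k) *\<^sub>R mat_pow A k)"

definition lie_group_matrix :: "(3 \<Rightarrow> 'm vfield) \<Rightarrow> real \<Rightarrow> real \<Rightarrow> real \<Rightarrow> real^3^3" where
  "lie_group_matrix E a b c = mat_exp (lie_algebra_matrix E a b c)"

end

(* Since psi is a Lie algebra isomorphism, psi o E is a basis of the Lie algebra of G with the
   structure constants of E, which determine A. In the classes F1, F5, F11 one has A^2 = r A, where
   r is the trace of A or half of it, and in the other classes A^3 = r A, where r is half the trace
   of A^2. Hence all powers of A are multiples of A and A^2, and the exponential series splits into
   scalar series. *)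

theory Submission
  imports Defs
begin

section \<open>Smooth functions\<close>

text \<open>On an open set a derivative depends only on nearby values inside the set, so agreement
  on \<open>S\<close> passes to derivatives of every order.\<close>

lemma Ck_on_cong:
  assumes "open S" "\<And>x. x \<in> S \<Longrightarrow> f x = h x"
  shows "Ck_on k S f \<longleftrightarrow> Ck_on k S h"
  using assms(2)
proof (induction k arbitrary: f h)
  case 0
  then show ?case
    by (simp cong: continuous_on_cong)
next
  case (Suc k)
  have deriv: "(f has_derivative d) (at x) \<longleftrightarrow> (h has_derivative d) (at x)"
    if "x \<in> S" for x d
  proof
    show "(h has_derivative d) (at x)" if "(f has_derivative d) (at x)"
      using has_derivative_transform_within_open[OF that \<open>open S\<close> \<open>x \<in> S\<close>] Suc.prems by simp
    show "(f has_derivative d) (at x)" if "(h has_derivative d) (at x)"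
      using has_derivative_transform_within_open[OF that \<open>open S\<close> \<open>x \<in> S\<close>] Suc.prems by simp
  qed
  \<comment> \<open>\<open>frechet_derivative\<close> is a choice from the predicate
    \<open>has_derivative\<close>, so equivalent predicates yield the same derivative.\<close>
  have "Ck_on k S (\<lambda>x. frechet_derivative f (at x) v) \<longleftrightarrow>
      Ck_on k S (\<lambda>x. frechet_derivative h (at x) v)" for v
    by (intro Suc.IH) (simp add: frechet_derivative_def deriv)
  then show ?case
    by (simp add: differentiable_def deriv)
qed

lemma Ck_on_add:
  assumes "open S" "Ck_on k S f" "Ck_on k S h"
  shows "Ck_on k S (\<lambda>x. f x + h x)"
  using assms(2,3)
proof (induction k arbitrary: f h)
  case 0
  then show ?case
    by (simp add: continuous_on_add)
next
  case (Suc k)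
  have deriv: "frechet_derivative (\<lambda>x. f x + h x) (at x) v =
      frechet_derivative f (at x) v + frechet_derivative h (at x) v" if "x \<in> S" for x v
  proof -
    have "(f has_derivative frechet_derivative f (at x)) (at x)"
      "(h has_derivative frechet_derivative h (at x)) (at x)"
      using Suc.prems that by (simp_all flip: frechet_derivative_works)
    from frechet_derivative_at[OF has_derivative_add[OF this]] show ?thesis
      by (rule fun_cong[symmetric])
  qed
  have "Ck_on k S (\<lambda>x. frechet_derivative (\<lambda>x. f x + h x) (at x) v)" for v
    \<comment> \<open>The sum rule is known only at points of \<open>S\<close>; it enters by
      congruence on \<open>S\<close>, not as an equality of functions.\<close>
    using Suc by (subst Ck_on_cong[OF \<open>open S\<close> deriv]) simp_all
  with Suc.prems show ?case
    by simp
qed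

lemma Ck_on_scaleR:
  assumes "open S" "Ck_on k S f"
  shows "Ck_on k S (\<lambda>x. c *\<^sub>R f x)"
  using assms(2)
proof (induction k arbitrary: f)
  case 0
  then show ?case
    by (simp add: continuous_on_scaleR)
next
  case (Suc k)
  have deriv: "frechet_derivative (\<lambda>x. c *\<^sub>R f x) (at x) v = c *\<^sub>R frechet_derivative f (at x) v"
    if "x \<in> S" for x v
  proof -
    have "(f has_derivative frechet_derivative f (at x)) (at x)"
      using Suc.prems that by (simp flip: frechet_derivative_works)
    from frechet_derivative_at[OF bounded_linear.has_derivative[OF bounded_linear_scaleR_right this]]
    show ?thesis
      by (rule fun_cong[symmetric])
  qed
  have "Ck_on k S (\<lambda>x. frechet_derivative (\<lambda>x. c *\<^sub>R f x) (at x) v)" for v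
    using Suc by (subst Ck_on_cong[OF \<open>open S\<close> deriv]) simp_all
  with Suc.prems show ?case
    by simp
qed

text \<open>Chart images are open, so \<open>Ck_on_add\<close> applies in every chart.\<close>

lemma smooth_fun_add:
  assumes "smooth_manifold3 \<A>" "smooth_fun \<A> f" "smooth_fun \<A> h"
  shows "smooth_fun \<A> (\<lambda>p. f p + h p)"
  using assms by (fastforce simp: smooth_fun_def smooth_on_def smooth_manifold3_def intro!: Ck_on_add)

lemma smooth_fun_mult_const:
  assumes "smooth_manifold3 \<A>" "smooth_fun \<A> f"
  shows "smooth_fun \<A> (\<lambda>p. c * f p)"
  using assms Ck_on_scaleR[where 'b = real]
  by (fastforce simp: smooth_fun_def smooth_on_def smooth_manifold3_def)

section \<open>The Lie algebra as a vector space\<close>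

text \<open>The Leibniz rule, left invariance and the value 0 off the smooth functions are linear
  conditions on the field; smoothness of the result is closure under sums.\<close>

lemma vf_add_in_lie_algebra:
  assumes "smooth_manifold3 (atlas L)" "X \<in> lie_algebra L" "Y \<in> lie_algebra L"
  shows "vf_add X Y \<in> lie_algebra L"
  using assms
  by (auto simp: lie_algebra_def vector_field_def left_invariant_def vf_add_def smooth_fun_add
      algebra_simps)

text \<open>The factor is constant because left invariance does not survive general smooth
  factors.\<close>

lemma vf_scale_in_lie_algebra:
  assumes "smooth_manifold3 (atlas L)" "X \<in> lie_algebra L"
  shows "vf_scale (\<lambda>_. c) X \<in> lie_algebra L"
  using assms
  by (auto simp: lie_algebra_def vector_field_def left_invariant_def vf_scale_def
      smooth_fun_mult_const algebra_simps)

text \<open>Turns the indices 1, 2, 3 of \<open>sum_3\<close> and \<open>forall_3\<close> into the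
  frame indices 0, 1, 2.\<close>

lemma three_eq_zero: "(3::3) = 0"
  by simp

lemma sum_index3: "(\<Sum>i\<in>(UNIV::3 set). f i) = f 0 + f 1 + f 2"
  for f :: "3 \<Rightarrow> 'a::comm_monoid_add"
  unfolding sum_3 three_eq_zero by (simp add: ac_simps)

lemma forall_index3: "(\<forall>i::3. P i) \<longleftrightarrow> P 0 \<and> P 1 \<and> P 2"
  unfolding forall_3 three_eq_zero by blast

text \<open>Expresses combinations by the two operations that \<open>lie_algebra_iso\<close>
  preserves.\<close>

lemma lin_comb_conv_vf_add:
  "lin_comb c E = vf_add (vf_add (vf_scale (\<lambda>_. c $ 0) (E 0)) (vf_scale (\<lambda>_. c $ 1) (E 1)))
     (vf_scale (\<lambda>_. c $ 2) (E 2))"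
  by (simp add: lin_comb_def frame_comb_def vf_add_def vf_scale_def sum_index3)

lemma lin_comb_in_lie_algebra:
  assumes "smooth_manifold3 (atlas L)" "\<And>i. E i \<in> lie_algebra L"
  shows "lin_comb c E \<in> lie_algebra L"
  unfolding lin_comb_conv_vf_add
  by (intro vf_add_in_lie_algebra vf_scale_in_lie_algebra assms)

section \<open>Transport of the structure constants along the isomorphism\<close>

lemma lie_algebra_iso_lin_comb:
  assumes "smooth_manifold3 (atlas L)" "\<And>i. E i \<in> lie_algebra L" "lie_algebra_iso L G \<psi>"
  shows "\<psi> (lin_comb c E) = lin_comb c (\<lambda>i. \<psi> (E i))"
  using assms
  by (simp add: lin_comb_conv_vf_add lie_algebra_iso_def vf_add_in_lie_algebra
      vf_scale_in_lie_algebra)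

text \<open>\<psi> carries the bracket relation to the images of the frame. Since
  \<open>structure_const\<close> is a \<open>THE\<close>, uniqueness of the coefficients is needed
  too; it is pulled back to \<open>E\<close> by injectivity.\<close>

lemma structure_const_iso:
  assumes mfd: "smooth_manifold3 (atlas L)"
    and basis: "lie_algebra_basis L E"
    and iso: "lie_algebra_iso L G \<psi>"
    and br: "bracket (E i) (E j) = lin_comb c E"
  shows "structure_const (\<lambda>i. \<psi> (E i)) i j = c"
proof -
  have E: "E i \<in> lie_algebra L" for i
    using basis by (simp add: lie_algebra_basis_def)
  note lin = lie_algebra_iso_lin_comb[OF mfd E iso]
  note closed = lin_comb_in_lie_algebra[OF mfd E]
  have "bracket (\<psi> (E i)) (\<psi> (E j)) = \<psi> (bracket (E i) (E j))"
    using iso E by (simp add: lie_algebra_iso_def)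
  also have "\<dots> = lin_comb c (\<lambda>i. \<psi> (E i))"
    by (simp add: br lin)
  finally have eq: "bracket (\<psi> (E i)) (\<psi> (E j)) = lin_comb c (\<lambda>i. \<psi> (E i))" .
  have "d = c" if "lin_comb c (\<lambda>i. \<psi> (E i)) = lin_comb d (\<lambda>i. \<psi> (E i))" for d
  proof -
    have "\<psi> (lin_comb c E) = \<psi> (lin_comb d E)"
      using that by (simp add: lin)
    moreover have "inj_on \<psi> (lie_algebra L)"
      using iso by (auto simp: lie_algebra_iso_def bij_betw_def)
    \<comment> \<open>\<psi> is injective only on the Lie algebra, so both combinations must be
      known to lie in it.\<close>
    ultimately have "lin_comb c E = lin_comb d E"
      using closed by (auto dest: inj_onD)
    moreover have "\<exists>!k. lin_comb c E = lin_comb k E"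
      using basis closed by (auto simp only: lie_algebra_basis_def)
    ultimately show "d = c"
      by auto
  qed
  then show ?thesis
    unfolding structure_const_def eq by (intro the_equality) auto
qed

lemma bracket_swap_lin_comb:
  assumes "bracket X Y = lin_comb c E"
  shows "bracket Y X = lin_comb (- c) E"
proof -
  have "bracket Y X = (\<lambda>f p. - bracket X Y f p)"
    by (simp add: bracket_def)
  then show ?thesis
    by (simp add: assms lin_comb_def frame_comb_def sum_index3)
qed

lemma bracket_self_lin_comb: "bracket X X = lin_comb 0 E"
  by (simp add: bracket_def lin_comb_def frame_comb_def)

lemma tup3_nth [simp]:
  "tup3 x y z $ 0 = x" "tup3 x y z $ 1 = y" "tup3 x y z $ 2 = z"
  by (simp_all add: tup3_def)

text \<open>Row j is -(a C_0j + b C_1j + c C_2j); antisymmetry of the bracket reduces it to the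
  three listed commutators.\<close>

lemma lie_algebra_matrix_iso:
  assumes "smooth_manifold3 (atlas L)" "lie_algebra_basis L E" "lie_algebra_iso L G \<psi>"
    and comm: "has_class_commutators E s \<alpha> \<beta>"
  shows "lie_algebra_matrix (\<lambda>i. \<psi> (E i)) a b c =
    (case class_commutators s \<alpha> \<beta> of (c01, c02, c12) \<Rightarrow>
      tup3 (b *\<^sub>R c01 + c *\<^sub>R c02) (c *\<^sub>R c12 - a *\<^sub>R c01) (- a *\<^sub>R c02 - b *\<^sub>R c12))"
proof -
  obtain c01 c02 c12 where cc: "class_commutators s \<alpha> \<beta> = (c01, c02, c12)"
    by (rule prod_cases3)
  have br: "bracket (E 0) (E 1) = lin_comb c01 E" "bracket (E 0) (E 2) = lin_comb c02 E"
      "bracket (E 1) (E 2) = lin_comb c12 E"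
    using comm by (simp_all add: has_class_commutators_def cc)
  note sc = structure_const_iso[OF assms(1-3)]
  \<comment> \<open>All nine structure constants: the three given, the three reversed and the
    diagonal ones.\<close>
  note coeffs = br[THEN sc] br[THEN bracket_swap_lin_comb, THEN sc] sc[OF bracket_self_lin_comb]
  show ?thesis
    unfolding cc lie_algebra_matrix_def basis_matrix_def vec_eq_iff forall_index3
    by (simp add: coeffs)
qed

section \<open>Matrix exponentials\<close>

lemma mat_exp_eqI:
  assumes "(\<lambda>n. (1 / fact n) *\<^sub>R mat_pow A n) sums S"
  shows "mat_exp A = S"
  using assms unfolding mat_exp_def by (rule sums_unique[symmetric])

lemma matrix_mult_scaleR_right: "A ** (c *\<^sub>R B) = c *\<^sub>R (A ** B)"
  for A :: "real^'n^'m" and B :: "real^'k^'n"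
  by (simp add: matrix_scalar_ac flip: scalar_matrix_assoc)

text \<open>Each further factor A contributes one r. The exponent starts at 1, as the identity need
  not be a multiple of A.\<close>

lemma mat_pow_Suc_square:
  assumes "A ** A = r *\<^sub>R A"
  shows "mat_pow A (Suc n) = r ^ n *\<^sub>R A"
proof (induction n)
  case (Suc n)
  have "mat_pow A (Suc (Suc n)) = A ** mat_pow A (Suc n)"
    by simp
  then show ?case
    unfolding Suc by (simp add: matrix_mult_scaleR_right assms)
qed simp

text \<open>The case r = 0 of the next lemma, where its quotient is meaningless and the series stops
  after two terms.\<close>

lemma mat_exp_square_zero:
  assumes "A ** A = 0"
  shows "mat_exp A = mat 1 + A"
proof (rule mat_exp_eqI)
  \<comment> \<open>Here \<open>0 ^ n\<close> is 1 for n = 0, so exactly the first power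
    survives.\<close>
  have pow: "mat_pow A (Suc n) = 0 ^ n *\<^sub>R A" for n
    using assms by (intro mat_pow_Suc_square) simp
  have "(1 / fact n) *\<^sub>R mat_pow A n = 0" if "n \<notin> {0, 1}" for n
    using that pow[of "n - 1"] by (cases n) auto
  then have "(\<lambda>n. (1 / fact n) *\<^sub>R mat_pow A n) sums (\<Sum>n\<in>{0,1}. (1 / fact n) *\<^sub>R mat_pow A n)"
    by (intro sums_finite) auto
  then show "(\<lambda>n. (1 / fact n) *\<^sub>R mat_pow A n) sums (mat 1 + A)"
    by simp
qed

text \<open>The series of r^(n-1) / n! over n >= 1 is that of exp r without its constant term,
  divided by r.\<close>

lemma mat_exp_square:
  assumes "A ** A = r *\<^sub>R A" "r \<noteq> 0"
  shows "mat_exp A = mat 1 + ((exp r - 1) / r) *\<^sub>R A"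
proof (rule mat_exp_eqI)
  \<comment> \<open>\<delta> supplies the identity matrix at n = 0 and removes the constant term of
    the exponential series.\<close>
  define \<delta> :: "nat \<Rightarrow> real" where "\<delta> n = (if n = 0 then 1 else 0)" for n
  have \<delta>: "\<delta> sums 1"
    using sums_single[of 0 "\<lambda>_. 1::real"] by (simp add: \<delta>_def[abs_def] cong: if_cong)
  have "(\<lambda>n. (r ^ n /\<^sub>R fact n)) sums exp r"
    by (rule exp_converges)
  then have "(\<lambda>n. \<delta> n *\<^sub>R mat 1 + ((r ^ n /\<^sub>R fact n - \<delta> n) / r) *\<^sub>R A)
      sums (1 *\<^sub>R mat 1 + ((exp r - 1) / r) *\<^sub>R A)"
    by (intro sums_add sums_scaleR_left sums_divide sums_diff \<delta>)
  moreover have "\<delta> n *\<^sub>R mat 1 + ((r ^ n /\<^sub>R fact n - \<delta> n) / r) *\<^sub>R A =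
      (1 / fact n) *\<^sub>R mat_pow A n" for n
  proof (cases n)
    case (Suc m)
    show ?thesis
      unfolding Suc mat_pow_Suc_square[OF assms(1)] using \<open>r \<noteq> 0\<close>
      by (simp add: \<delta>_def field_simps del: fact_Suc)
  qed (simp add: \<delta>_def)
  ultimately show "(\<lambda>n. (1 / fact n) *\<^sub>R mat_pow A n) sums (mat 1 + ((exp r - 1) / r) *\<^sub>R A)"
    by simp
qed

text \<open>Two more factors A multiply both A and A^2 by r, so the powers from A on alternate
  between these two.\<close>

lemma mat_pow_cube:
  assumes "A ** (A ** A) = r *\<^sub>R A"
  shows "mat_pow A (2 * m + 1) = r ^ m *\<^sub>R A" "mat_pow A (2 * m + 2) = r ^ m *\<^sub>R (A ** A)"
proof -
  have "mat_pow A (2 * m + 1) = r ^ m *\<^sub>R A \<and> mat_pow A (2 * m + 2) = r ^ m *\<^sub>R (A ** A)"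
    by (induction m) (simp_all add: matrix_mult_scaleR_right assms)
  then show "mat_pow A (2 * m + 1) = r ^ m *\<^sub>R A" "mat_pow A (2 * m + 2) = r ^ m *\<^sub>R (A ** A)"
    by blast+
qed

text \<open>The series \<open>\<sigma>\<close> and \<open>\<gamma>\<close> stand for those of \<open>w * sinh w\<close> and \<open>cosh w\<close> where \<open>r = w\<^sup>2\<close>, or of
  \<open>- w * sin w\<close> and \<open>cos w\<close> where \<open>r = - w\<^sup>2\<close>.\<close>

lemma mat_exp_cube:
  assumes cube: "A ** (A ** A) = r *\<^sub>R A" and "r \<noteq> 0"
    and "\<sigma> sums s" "\<gamma> sums c"
    and odd: "\<And>m. \<sigma> (2 * m + 1) = r ^ Suc m / fact (2 * m + 1)" "\<And>m. \<gamma> (2 * m + 1) = 0"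
    and even: "\<And>m. \<sigma> (2 * m) = 0" "\<And>m. \<gamma> (2 * m) = r ^ m / fact (2 * m)"
  shows "mat_exp A = mat 1 + (s / r) *\<^sub>R A + ((c - 1) / r) *\<^sub>R (A ** A)"
proof (rule mat_exp_eqI)
  define \<delta> :: "nat \<Rightarrow> real" where "\<delta> n = (if n = 0 then 1 else 0)" for n
  have \<delta>: "\<delta> sums 1"
    using sums_single[of 0 "\<lambda>_. 1::real"] by (simp add: \<delta>_def[abs_def] cong: if_cong)
  \<comment> \<open>Odd terms form the coefficient of A, even terms from 2 on that of A^2, and
    \<delta> takes the constant term out of \<open>\<gamma>\<close>.\<close>
  have "(\<lambda>n. \<delta> n *\<^sub>R mat 1 + (\<sigma> n / r) *\<^sub>R A + ((\<gamma> n - \<delta> n) / r) *\<^sub>R (A ** A))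
      sums (1 *\<^sub>R mat 1 + (s / r) *\<^sub>R A + ((c - 1) / r) *\<^sub>R (A ** A))"
    by (intro sums_add sums_scaleR_left sums_divide sums_diff \<delta> assms)
  moreover have "\<delta> n *\<^sub>R mat 1 + (\<sigma> n / r) *\<^sub>R A + ((\<gamma> n - \<delta> n) / r) *\<^sub>R (A ** A) =
      (1 / fact n) *\<^sub>R mat_pow A n" for n
  proof -
    consider "n = 0" | m where "n = 2 * m + 1" | m where "n = 2 * m + 2"
      by (metis Suc_eq_plus1 add_2_eq_Suc' add_cancel_left_right even_Suc evenE mult_Suc_right
          not0_implies_Suc oddE add.commute mult.commute)
    then show ?thesis
    proof cases
      case 1
      then show ?thesis
        using even[of 0] by (simp add: \<delta>_def)
    next
      case 2
      show ?thesis
        unfolding 2 mat_pow_cube[OF cube] odd using \<open>r \<noteq> 0\<close>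
        by (simp add: \<delta>_def field_simps del: fact_Suc)
    next
      case 3
      \<comment> \<open>n is twice \<open>Suc m\<close>; the extra factor r cancels against the
        division by r.\<close>
      then have "\<sigma> n = 0" "\<gamma> n = r ^ Suc m / fact n" "\<delta> n = 0"
        using even[of "Suc m"] by (simp_all add: \<delta>_def del: fact_Suc)
      then show ?thesis
        using \<open>r \<noteq> 0\<close> mat_pow_cube(2)[OF cube, of m]
        by (simp add: 3 del: fact_Suc mat_pow.simps)
    qed
  qed
  ultimately show "(\<lambda>n. (1 / fact n) *\<^sub>R mat_pow A n)
      sums (mat 1 + (s / r) *\<^sub>R A + ((c - 1) / r) *\<^sub>R (A ** A))"
    by simp
qed

lemma mat_exp_cube_pos:
  assumes cube: "A ** (A ** A) = r *\<^sub>R A" and "r > 0"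
  shows "mat_exp A = mat 1 + (sinh (sqrt r) / sqrt r) *\<^sub>R A + ((cosh (sqrt r) - 1) / r) *\<^sub>R (A ** A)"
proof -
  define w where "w = sqrt r"
  have w: "r = w * w" "w \<noteq> 0"
    using assms by (auto simp: w_def)
  have pow: "r ^ m = w ^ (2 * m)" "r ^ Suc m = w * w * w ^ (2 * m)" for m
    by (simp_all add: w(1) power_mult power2_eq_square)
  \<comment> \<open>The sinh series is multiplied by w so that its odd terms w^(2m+2) / (2m+1)! are
    in powers of r; dividing by r = w^2 leaves sinh w / w.\<close>
  have "mat_exp A = mat 1 + (w * sinh w / r) *\<^sub>R A + ((cosh w - 1) / r) *\<^sub>R (A ** A)"
    by (rule mat_exp_cube[OF cube _ sums_mult[OF sinh_converges] cosh_converges])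
      (use \<open>r > 0\<close> in \<open>simp_all add: pow divide_inverse del: power_Suc fact_Suc\<close>,
        simp_all del: fact_Suc)
  moreover have "w * sinh w / r = sinh w / w"
    by (simp add: w)
  ultimately show ?thesis
    by (simp only: flip: w_def)
qed

lemma mat_exp_cube_neg:
  assumes cube: "A ** (A ** A) = r *\<^sub>R A" and "r < 0"
  shows "mat_exp A =
    mat 1 + (sin (sqrt (- r)) / sqrt (- r)) *\<^sub>R A + ((cos (sqrt (- r)) - 1) / r) *\<^sub>R (A ** A)"
proof -
  define w where "w = sqrt (- r)"
  have w: "r = - (w * w)" "w \<noteq> 0"
    using assms by (auto simp: w_def)
  have pow: "r ^ m = (- 1) ^ m * w ^ (2 * m)" for m
    by (simp add: w(1) power_mult power2_eq_square flip: power_mult_distrib)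
  then have pow_Suc: "r ^ Suc m = - (w * w) * ((- 1) ^ m * w ^ (2 * m))" for m
    by (simp add: w(1))
  \<comment> \<open>The factor -w turns (-1)^m w^(2m+1) into (-w^2)^(m+1) = r^(m+1).\<close>
  have "mat_exp A = mat 1 + (- w * sin w / r) *\<^sub>R A + ((cos w - 1) / r) *\<^sub>R (A ** A)"
    by (rule mat_exp_cube[OF cube _ sums_mult[OF sin_converges] cos_converges])
      (use \<open>r < 0\<close> in \<open>simp_all add: pow pow_Suc sin_coeff_def cos_coeff_def del: power_Suc fact_Suc\<close>,
        simp_all del: fact_Suc)
  moreover have "- w * sin w / r = sin w / w"
    by (simp add: w)
  ultimately show ?thesis
    by (simp only: flip: w_def)
qed


section \<open>The matrix and its exponential in each basic class\<close>

theorem theorem3p1: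
  fixes L :: "'l::{t2_space,second_countable_topology} lie_group_data"
    and E :: "3 \<Rightarrow> 'l vfield"
    and \<phi> :: "'l vfield \<Rightarrow> 'l vfield"
    and \<xi> :: "'l vfield"
    and \<eta> :: "'l vfield \<Rightarrow> 'l \<Rightarrow> real"
    and g :: "'l vfield \<Rightarrow> 'l vfield \<Rightarrow> 'l \<Rightarrow> real"
    and D :: "'l vfield \<Rightarrow> 'l vfield \<Rightarrow> 'l vfield"
    and s :: basic_class
    and \<alpha> \<beta> :: real
    and G :: "'g::{t2_space,second_countable_topology} lie_group_data"
    and \<psi> :: "'l vfield \<Rightarrow> 'g vfield"
  assumes "lie_group3 L"
    and "connected (UNIV :: 'l set)"
    and "apapr_manifold3 (atlas L) \<phi> \<xi> \<eta> g"
    and "left_invariant_structure L E \<phi> \<xi> \<eta> g"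
    and "levi_civita (atlas L) g D"
    and "in_basic_class (atlas L) E \<phi> g D s"
    and "has_class_commutators E s \<alpha> \<beta>"
    and "nonzero_parameters s \<alpha> \<beta>"
    and "lie_group3 G"
    and "lie_algebra_iso L G \<psi>"
  shows "\<forall>a b c.
    let A = lie_algebra_matrix (\<lambda>i. \<psi> (E i)) a b c;
        T1 = trace A;
        T2 = trace (A ** A);
        rep = (\<lambda>t u. lie_group_matrix (\<lambda>i. \<psi> (E i)) a b c = mat 1 + t *\<^sub>R A + u *\<^sub>R (A ** A))
    in case s of
      F1 \<Rightarrow>
        A = tup3 (tup3 0 0 0)
                 (tup3 0 (\<alpha>*c) (-(\<beta>*c)))
                 (tup3 0 (-(\<alpha>*b)) (\<beta>*b)) \<and>
        T1 = \<alpha>*c + \<beta>*b \<and>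
        (T1 \<noteq> 0 \<longrightarrow> rep ((exp T1 - 1) / T1) 0) \<and>
        (T1 = 0 \<longrightarrow> rep 1 0)
    | F4 \<Rightarrow>
        A = tup3 (tup3 0 (\<alpha>*c) (\<alpha>*b))
                 (tup3 0 0 (-(\<alpha>*a)))
                 (tup3 0 (-(\<alpha>*a)) 0) \<and>
        T2 = 2 * \<alpha>^2 * a^2 \<and>
        (T2 > 0 \<longrightarrow> rep (sinh (sqrt (1/2 * T2)) / sqrt (1/2 * T2))
                          ((cosh (sqrt (1/2 * T2)) - 1) / (1/2 * T2))) \<and>
        (T2 = 0 \<longrightarrow> rep 1 0)
    | F5 \<Rightarrow>
        A = tup3 (tup3 0 (\<alpha>*b) (\<alpha>*c))
                 (tup3 0 (-(\<alpha>*a)) 0)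
                 (tup3 0 0 (-(\<alpha>*a))) \<and>
        T1 = - 2 * \<alpha> * a \<and>
        (T1 \<noteq> 0 \<longrightarrow> rep ((exp (1/2 * T1) - 1) / (1/2 * T1)) 0) \<and>
        (T1 = 0 \<longrightarrow> rep 1 0)
    | F8 \<Rightarrow>
        A = tup3 (tup3 0 (-(\<alpha>*c)) (\<alpha>*b))
                 (tup3 (2*\<alpha>*c) 0 (-(\<alpha>*a)))
                 (tup3 (-(2*\<alpha>*b)) (\<alpha>*a) 0) \<and>
        T2 = - 2 * \<alpha>^2 * (a^2 + 2*b^2 + 2*c^2) \<and>
        (T2 < 0 \<longrightarrow> rep (sin (sqrt (- (1/2) * T2)) / sqrt (- (1/2) * T2))
                          ((cos (sqrt (- (1/2) * T2)) - 1) / (1/2 * T2)))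
    | F9 \<Rightarrow>
        A = tup3 (tup3 0 (\<alpha>*b) (-(\<alpha>*c)))
                 (tup3 0 (-(\<alpha>*a)) 0)
                 (tup3 0 0 (\<alpha>*a)) \<and>
        T2 = 2 * \<alpha>^2 * a^2 \<and>
        (T2 > 0 \<longrightarrow> rep (sinh (sqrt (1/2 * T2)) / sqrt (1/2 * T2))
                          ((cosh (sqrt (1/2 * T2)) - 1) / (1/2 * T2))) \<and>
        (T2 = 0 \<longrightarrow> rep 1 0)
    | F10 \<Rightarrow>
        A = tup3 (tup3 0 (\<alpha>*c) (-(\<alpha>*b)))
                 (tup3 0 0 (\<alpha>*a))
                 (tup3 0 (-(\<alpha>*a)) 0) \<and>
        T2 = - 2 * \<alpha>^2 * a^2 \<and>
        (T2 < 0 \<longrightarrow> rep (sin (sqrt (- (1/2) * T2)) / sqrt (- (1/2) * T2))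
                          ((cos (sqrt (- (1/2) * T2)) - 1) / (1/2 * T2))) \<and>
        (T2 = 0 \<longrightarrow> rep 1 0)
    | F11 \<Rightarrow>
        A = tup3 (tup3 (\<alpha>*b + \<beta>*c) 0 0)
                 (tup3 (-(\<alpha>*a)) 0 0)
                 (tup3 (-(\<beta>*a)) 0 0) \<and>
        T1 = \<alpha>*b + \<beta>*c \<and>
        (T1 \<noteq> 0 \<longrightarrow> rep ((exp T1 - 1) / T1) 0) \<and>
        (T1 = 0 \<longrightarrow> rep 1 0)"
proof (intro allI, goal_cases)
  case (1 a b c)
  note entries = vec_eq_iff forall_index3 trace_def matrix_matrix_mult_def sum_index3
  define A where "A = lie_algebra_matrix (\<lambda>i. \<psi> (E i)) a b c"
  have "smooth_manifold3 (atlas L)" "lie_algebra_basis L E"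
    using assms by (simp_all add: lie_group3_def left_invariant_structure_def)
  note matrix = lie_algebra_matrix_iso[OF this \<open>lie_algebra_iso L G \<psi>\<close>
      \<open>has_class_commutators E s \<alpha> \<beta>\<close>, of a b c, folded A_def]
  \<comment> \<open>The zero multiple of A^2 gives u = 0 the shape of \<open>rep\<close>.\<close>
  have exp1: "mat_exp A = mat 1 + ((exp r - 1) / r) *\<^sub>R A + 0 *\<^sub>R (A ** A)"
    if "A ** A = r *\<^sub>R A" "r \<noteq> 0" for r
    using mat_exp_square[OF that] by simp
  have exp0: "mat_exp A = mat 1 + 1 *\<^sub>R A + 0 *\<^sub>R (A ** A)" if "A ** A = 0"
    using mat_exp_square_zero[OF that] by simp
  note exp_pos = mat_exp_cube_pos[of A "1/2 * trace (A ** A)"]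
  have exp_neg: "mat_exp A = mat 1
      + (sin (sqrt (- (1/2) * trace (A ** A))) / sqrt (- (1/2) * trace (A ** A))) *\<^sub>R A
      + ((cos (sqrt (- (1/2) * trace (A ** A))) - 1) / (1/2 * trace (A ** A))) *\<^sub>R (A ** A)"
    if "A ** (A ** A) = (1/2 * trace (A ** A)) *\<^sub>R A" "trace (A ** A) < 0"
    using mat_exp_cube_neg[OF that(1)] that(2) by simp
  note goal_simps = Let_def lie_group_matrix_def A_def[symmetric] basic_class.case
  show ?case
  proof (cases s)
    case F1
    have A: "A = tup3 (tup3 0 0 0) (tup3 0 (\<alpha>*c) (-(\<beta>*c))) (tup3 0 (-(\<alpha>*b)) (\<beta>*b))"
      unfolding matrix F1 vec_eq_iff forall_index3 by simp
    \<comment> \<open>A is the column (0, c, -b) times the row (0, \<alpha>, -\<beta>); a matrix of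
      rank at most one satisfies A^2 = tr(A) A.\<close>
    have tr: "trace A = \<alpha>*c + \<beta>*b" and sq: "A ** A = trace A *\<^sub>R A"
      unfolding A entries by (simp_all add: algebra_simps power2_eq_square)
    show ?thesis
      unfolding goal_simps F1
      by (intro conjI impI A tr exp1 exp0 sq) (simp_all add: sq)
  next
    case F4
    have A: "A = tup3 (tup3 0 (\<alpha>*c) (\<alpha>*b)) (tup3 0 0 (-(\<alpha>*a))) (tup3 0 (-(\<alpha>*a)) 0)"
      unfolding matrix F4 vec_eq_iff forall_index3 by simp
    \<comment> \<open>In this class and in \<open>F8\<close>, \<open>F9\<close>, \<open>F10\<close>
      both tr A and det A vanish, so Cayley-Hamilton predicts A^3 = (tr A^2 / 2) A. It is checked
      entrywise.\<close>
    have tr: "trace (A ** A) = 2 * \<alpha>^2 * a^2"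
      and cube: "A ** (A ** A) = (1/2 * trace (A ** A)) *\<^sub>R A"
      unfolding A entries by (simp_all add: algebra_simps power2_eq_square)
    \<comment> \<open>Once \<alpha> a = 0 only the first row is left, and its first entry is 0, so A
      is nilpotent.\<close>
    have "A ** A = 0" if "trace (A ** A) = 0"
    proof -
      have "\<alpha> * a = 0"
        using that tr by simp
      then show ?thesis
        unfolding A entries by auto
    qed
    then show ?thesis
      unfolding goal_simps F4
      by (intro conjI impI A tr exp_pos exp0 cube) simp
  next
    case F5
    have A: "A = tup3 (tup3 0 (\<alpha>*b) (\<alpha>*c)) (tup3 0 (-(\<alpha>*a)) 0) (tup3 0 0 (-(\<alpha>*a)))"
      unfolding matrix F5 vec_eq_iff forall_index3 by simp
    \<comment> \<open>The eigenvalue -\<alpha> a occurs twice in the trace, hence the factor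
      1/2.\<close>
    have tr: "trace A = - 2 * \<alpha> * a" and sq: "A ** A = (1/2 * trace A) *\<^sub>R A"
      unfolding A entries by (simp_all add: algebra_simps power2_eq_square)
    show ?thesis
      unfolding goal_simps F5
      by (intro conjI impI A tr exp1 exp0 sq) (simp_all add: sq)
  next
    case F8
    have A: "A = tup3 (tup3 0 (-(\<alpha>*c)) (\<alpha>*b)) (tup3 (2*\<alpha>*c) 0 (-(\<alpha>*a)))
        (tup3 (-(2*\<alpha>*b)) (\<alpha>*a) 0)"
      unfolding matrix F8 vec_eq_iff forall_index3 by simp
    \<comment> \<open>As \<alpha> is nonzero, tr A^2 vanishes only for a = b = c = 0; otherwise it
      is negative.\<close>
    have tr: "trace (A ** A) = - 2 * \<alpha>^2 * (a^2 + 2*b^2 + 2*c^2)"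
      and cube: "A ** (A ** A) = (1/2 * trace (A ** A)) *\<^sub>R A"
      unfolding A entries by (simp_all add: algebra_simps power2_eq_square)
    show ?thesis
      unfolding goal_simps F8
      by (intro conjI impI A tr exp_neg cube)
  next
    case F9
    have A: "A = tup3 (tup3 0 (\<alpha>*b) (-(\<alpha>*c))) (tup3 0 (-(\<alpha>*a)) 0) (tup3 0 0 (\<alpha>*a))"
      unfolding matrix F9 vec_eq_iff forall_index3 by simp
    have tr: "trace (A ** A) = 2 * \<alpha>^2 * a^2"
      and cube: "A ** (A ** A) = (1/2 * trace (A ** A)) *\<^sub>R A"
      unfolding A entries by (simp_all add: algebra_simps power2_eq_square)
    have "A ** A = 0" if "trace (A ** A) = 0"
    proof -
      have "\<alpha> * a = 0"
        using that tr by simp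
      then show ?thesis
        unfolding A entries by auto
    qed
    then show ?thesis
      unfolding goal_simps F9
      by (intro conjI impI A tr exp_pos exp0 cube) simp
  next
    case F10
    \<comment> \<open>From C_01^2 = -\<alpha> and C_02^1 = \<alpha> the lower block is
      skew-symmetric: it generates rotations, so tr A^2 <= 0 and sin and cos appear. The symmetric
      block and the hyperbolic functions of the English statement do not fit these
      commutators.\<close>
    have A: "A = tup3 (tup3 0 (\<alpha>*c) (-(\<alpha>*b))) (tup3 0 0 (\<alpha>*a)) (tup3 0 (-(\<alpha>*a)) 0)"
      unfolding matrix F10 vec_eq_iff forall_index3 by simp
    have tr: "trace (A ** A) = - 2 * \<alpha>^2 * a^2"
      and cube: "A ** (A ** A) = (1/2 * trace (A ** A)) *\<^sub>R A"
      unfolding A entries by (simp_all add: algebra_simps power2_eq_square)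
    have "A ** A = 0" if "trace (A ** A) = 0"
    proof -
      have "\<alpha> * a = 0"
        using that tr by simp
      then show ?thesis
        unfolding A entries by auto
    qed
    then show ?thesis
      unfolding goal_simps F10
      by (intro conjI impI A tr exp_neg exp0 cube)
  next
    case F11
    have A: "A = tup3 (tup3 (\<alpha>*b + \<beta>*c) 0 0) (tup3 (-(\<alpha>*a)) 0 0) (tup3 (-(\<beta>*a)) 0 0)"
      unfolding matrix F11 vec_eq_iff forall_index3 by simp
    \<comment> \<open>Again rank at most one: only the first column is nonzero.\<close>
    have tr: "trace A = \<alpha>*b + \<beta>*c" and sq: "A ** A = trace A *\<^sub>R A"
      unfolding A entries by (simp_all add: algebra_simps power2_eq_square)
    show ?thesis
      unfolding goal_simps F11
      by (intro conjI impI A tr exp1 exp0 sq) (simp_all add: sq)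
  qed
qed

end
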